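(* Let $M$ be a pointed metric space such that $\operatorname{dens}(M')=\Gamma$ for some infinite cardinal $\Gamma$, where $M'$ denotes the set of all cluster points of $M$. Then there is a linear subspace of $\operatorname{Lip}_0(M)$, contained in $\operatorname{SNA}(M)$, that is isometrically isomorphic to $c_0(\Gamma)$.
   Context: All vector spaces are real. A pointed metric space is a metric space $(M,d)$ with a distinguished point $0\in M$. $\operatorname{Lip}_0(M)$ is the Banach space of all Lipschitz functions $f:M\to\mathbb{R}$ with $f(0)=0$, with norm $\|f\|_{\operatorname{Lip}}=\sup\{|f(y)-f(x)|/d(x,y): x,y\in M,\ x\ne y\}$. A function $f\in\operatorname{Lip}_0(M)$ strongly attains its norm if there are distinct $p,q\in M$ with $\|f\|_{\operatorname{Lip}}=|f(p)-f(q)|/d(p,q)$. $\operatorname{SNA}(M)\subseteq\operatorname{Lip}_0(M)$ is the set of all functions that strongly attain their norm. For a metric space $N$, $\operatorname{dens}(N)$ is the smallest cardinality of a dense subset of $N$. For a set $\Gamma$, $c_0(\Gamma)$ is the space of all functions $x:\Gamma\to\mathbb{R}$ such that $\{\gamma\in\Gamma:|x(\gamma)|\ge\varepsilon\}$ is finite for every $\varepsilon>0$, with the supremum norm. *)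

theory Defs
  imports "HOL-Analysis.Analysis"
begin

unbundle cardinal_syntax

class pointed_metric_space = metric_space +
  fixes basepoint :: 'a

typedef (overloaded) ('a :: pointed_metric_space) lip0 =
  "{f :: 'a \<Rightarrow> real. (\<exists>L. L-lipschitz_on UNIV f) \<and> f basepoint = 0}"
  morphisms lip0_apply Abs_lip0
proof
  show "(\<lambda>_. 0) \<in> {f :: 'a \<Rightarrow> real. (\<exists>L. L-lipschitz_on UNIV f) \<and> f basepoint = 0}"
    by (auto intro!: exI[of _ 0] lipschitz_onI)
qed

setup_lifting type_definition_lip0

(* The inserted 0 only matters for a one-point space, where there are no slopes. *)
definition lip_const :: "('a :: metric_space \<Rightarrow> real) \<Rightarrow> real" where
  "lip_const f = Sup (insert 0 {\<bar>f y - f x\<bar> / dist x y | x y. x \<noteq> y})"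

lemma lip_const_bdd:
  assumes "L-lipschitz_on UNIV f"
  shows "bdd_above (insert 0 {\<bar>f y - f x\<bar> / dist x y | x y. x \<noteq> y})"
proof (rule bdd_aboveI)
  fix s assume "s \<in> insert 0 {\<bar>f y - f x\<bar> / dist x y | x y. x \<noteq> y}"
  then show "s \<le> L"
    using lipschitz_onD[OF assms] lipschitz_on_nonneg[OF assms]
    by (auto simp: dist_real_def divide_le_eq dist_commute abs_minus_commute)
qed

lemma lip_const_nonneg:
  assumes "L-lipschitz_on UNIV f"
  shows "0 \<le> lip_const f"
  unfolding lip_const_def by (rule cSup_upper[OF _ lip_const_bdd[OF assms]]) simp

lemma lip_const_bound:
  assumes "L-lipschitz_on UNIV f"
  shows "\<bar>f y - f x\<bar> \<le> lip_const f * dist x y"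
proof (cases "x = y")
  case False
  then have "\<bar>f y - f x\<bar> / dist x y \<le> lip_const f"
    unfolding lip_const_def by (intro cSup_upper[OF _ lip_const_bdd[OF assms]]) auto
  then show ?thesis using False by (simp add: divide_le_eq)
qed simp

lemma lip_const_least:
  assumes "0 \<le> L" "\<And>x y. \<bar>f y - f x\<bar> \<le> L * dist x y"
  shows "lip_const f \<le> L"
  unfolding lip_const_def
  by (rule cSup_least) (use assms in \<open>auto simp: divide_le_eq\<close>)

lemma lip_const_add:
  assumes f: "L-lipschitz_on UNIV f" and g: "K-lipschitz_on UNIV g"
  shows "lip_const (\<lambda>x. f x + g x) \<le> lip_const f + lip_const g"
proof (rule lip_const_least)
  show "0 \<le> lip_const f + lip_const g"
    using lip_const_nonneg[OF f] lip_const_nonneg[OF g] by simp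
  show "\<bar>f y + g y - (f x + g x)\<bar> \<le> (lip_const f + lip_const g) * dist x y" for x y
    using lip_const_bound[OF f, of y x] lip_const_bound[OF g, of y x]
    by (simp add: distrib_right)
qed

lemma lip_const_scale_le:
  assumes f: "L-lipschitz_on UNIV f"
  shows "lip_const (\<lambda>x. a * f x) \<le> \<bar>a\<bar> * lip_const f"
proof (rule lip_const_least)
  show "0 \<le> \<bar>a\<bar> * lip_const f"
    using lip_const_nonneg[OF f] by simp
  fix x y
  have "\<bar>a * f y - a * f x\<bar> = \<bar>a\<bar> * \<bar>f y - f x\<bar>"
    by (simp flip: abs_mult right_diff_distrib)
  also have "\<dots> \<le> \<bar>a\<bar> * (lip_const f * dist x y)"
    by (rule mult_left_mono[OF lip_const_bound[OF f]]) simp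
  finally show "\<bar>a * f y - a * f x\<bar> \<le> \<bar>a\<bar> * lip_const f * dist x y"
    by (simp add: mult.assoc)
qed

lemma lip_const_scale:
  assumes f: "L-lipschitz_on UNIV f"
  shows "lip_const (\<lambda>x. a * f x) = \<bar>a\<bar> * lip_const f"
proof (rule antisym[OF lip_const_scale_le[OF f]])
  have af: "(\<bar>a\<bar> * L)-lipschitz_on UNIV (\<lambda>x. a * f x)"
    using lipschitz_on_cmult_real[OF f] by simp
  show "\<bar>a\<bar> * lip_const f \<le> lip_const (\<lambda>x. a * f x)"
  proof (cases "a = 0")
    case True
    then show ?thesis using lip_const_nonneg[OF af] by simp
  next
    case False
    then have "f = (\<lambda>x. inverse a * (a * f x))"
      by (simp add: fun_eq_iff)
    then have "lip_const f \<le> \<bar>inverse a\<bar> * lip_const (\<lambda>x. a * f x)"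
      using lip_const_scale_le[OF af, of "inverse a"] by simp
    then have "\<bar>a\<bar> * lip_const f \<le> \<bar>a\<bar> * (\<bar>inverse a\<bar> * lip_const (\<lambda>x. a * f x))"
      by (rule mult_left_mono) simp
    also have "\<dots> = lip_const (\<lambda>x. a * f x)"
      using False by (simp add: abs_inverse)
    finally show ?thesis .
  qed
qed

lemma lip_const_eq_0:
  assumes L: "L-lipschitz_on UNIV f" and f0: "f z = 0"
  shows "lip_const f = 0 \<longleftrightarrow> f = (\<lambda>_. 0)"
proof
  assume "lip_const f = 0"
  then have "f x = 0" for x using lip_const_bound[OF L, of x z] f0 by simp
  then show "f = (\<lambda>_. 0)" by auto
next
  assume "f = (\<lambda>_. 0)"
  then have "lip_const f = lip_const (\<lambda>x. 0 * f x)" by simp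
  also have "\<dots> = 0" unfolding lip_const_scale[OF L] by simp
  finally show "lip_const f = 0" .
qed

instantiation lip0 :: (pointed_metric_space) real_normed_vector
begin

lift_definition zero_lip0 :: "'a lip0" is "\<lambda>_. 0"
  by (auto intro!: exI[of _ 0] lipschitz_onI)

lift_definition plus_lip0 :: "'a lip0 \<Rightarrow> 'a lip0 \<Rightarrow> 'a lip0" is "\<lambda>f g x. f x + g x"
  by (auto intro: lipschitz_on_add)

lift_definition minus_lip0 :: "'a lip0 \<Rightarrow> 'a lip0 \<Rightarrow> 'a lip0" is "\<lambda>f g x. f x - g x"
  by (auto intro: lipschitz_on_diff)

lift_definition uminus_lip0 :: "'a lip0 \<Rightarrow> 'a lip0" is "\<lambda>f x. - f x"
  by auto

lift_definition scaleR_lip0 :: "real \<Rightarrow> 'a lip0 \<Rightarrow> 'a lip0" is "\<lambda>c f x. c * f x"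
  by (auto intro: lipschitz_on_cmult_real)

lift_definition norm_lip0 :: "'a lip0 \<Rightarrow> real" is lip_const .

definition dist_lip0 :: "'a lip0 \<Rightarrow> 'a lip0 \<Rightarrow> real" where
  "dist_lip0 f g = norm (f - g)"

definition uniformity_lip0 :: "('a lip0 \<times> 'a lip0) filter" where
  "uniformity_lip0 = (INF e\<in>{0<..}. principal {(x, y). dist x y < e})"

definition open_lip0 :: "'a lip0 set \<Rightarrow> bool" where
  "open_lip0 U \<longleftrightarrow> (\<forall>x\<in>U. \<forall>\<^sub>F (x', y) in uniformity. x' = x \<longrightarrow> y \<in> U)"

definition sgn_lip0 :: "'a lip0 \<Rightarrow> 'a lip0" where
  "sgn_lip0 f = inverse (norm f) *\<^sub>R f"

instance
proof
  fix a b :: real and f g h :: "'a lip0" and U :: "'a lip0 set"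
  show "f + g + h = f + (g + h)" by transfer (simp add: add.assoc)
  show "f + g = g + f" by transfer (simp add: add.commute)
  show "0 + f = f" by transfer simp
  show "- f + f = 0" by transfer simp
  show "f - g = f + - g" by transfer simp
  show "a *\<^sub>R (f + g) = a *\<^sub>R f + a *\<^sub>R g" by transfer (simp add: distrib_left)
  show "(a + b) *\<^sub>R f = a *\<^sub>R f + b *\<^sub>R f" by transfer (simp add: distrib_right)
  show "a *\<^sub>R b *\<^sub>R f = (a * b) *\<^sub>R f" by transfer (simp add: mult.assoc)
  show "1 *\<^sub>R f = f" by transfer simp
  show "dist f g = norm (f - g)" by (rule dist_lip0_def)
  show "sgn f = inverse (norm f) *\<^sub>R f" by (rule sgn_lip0_def)
  show "(uniformity :: ('a lip0 \<times> 'a lip0) filter)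
      = (INF e\<in>{0<..}. principal {(x, y). dist x y < e})"
    by (rule uniformity_lip0_def)
  show "open U \<longleftrightarrow> (\<forall>x\<in>U. \<forall>\<^sub>F (x', y) in uniformity. x' = x \<longrightarrow> y \<in> U)"
    by (rule open_lip0_def)
  show "norm (f + g) \<le> norm f + norm g" by transfer (auto intro: lip_const_add)
  show "norm (a *\<^sub>R f) = \<bar>a\<bar> * norm f" by transfer (auto intro: lip_const_scale)
  show "norm f = 0 \<longleftrightarrow> f = 0"
  proof -
    obtain L where "L-lipschitz_on UNIV (lip0_apply f)" "lip0_apply f basepoint = 0"
      using lip0_apply[of f] by blast
    then have "lip_const (lip0_apply f) = 0 \<longleftrightarrow> lip0_apply f = (\<lambda>_. 0)"
      by (rule lip_const_eq_0)
    then show ?thesis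
      by (simp add: norm_lip0.rep_eq zero_lip0.rep_eq flip: lip0_apply_inject)
  qed
qed

end

definition SNA :: "('a :: pointed_metric_space) lip0 set" where
  "SNA = {f. \<exists>p q. p \<noteq> q \<and> norm f = \<bar>lip0_apply f p - lip0_apply f q\<bar> / dist p q}"

typedef 'g null_fun = "{x :: 'g \<Rightarrow> real. \<forall>\<epsilon>>0. finite {\<gamma>. \<bar>x \<gamma>\<bar> \<ge> \<epsilon>}}"
  morphisms null_apply Abs_null_fun
proof
  show "(\<lambda>_. 0) \<in> {x :: 'g \<Rightarrow> real. \<forall>\<epsilon>>0. finite {\<gamma>. \<bar>x \<gamma>\<bar> \<ge> \<epsilon>}}" by auto
qed

setup_lifting type_definition_null_fun

lemma null_fun_add:
  fixes x y :: "'g \<Rightarrow> real"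
  assumes "\<forall>\<epsilon>>0. finite {\<gamma>. \<bar>x \<gamma>\<bar> \<ge> \<epsilon>}" "\<forall>\<epsilon>>0. finite {\<gamma>. \<bar>y \<gamma>\<bar> \<ge> \<epsilon>}" "\<epsilon> > 0"
  shows "finite {\<gamma>. \<bar>x \<gamma> + y \<gamma>\<bar> \<ge> \<epsilon>}"
proof (rule finite_subset)
  show "{\<gamma>. \<bar>x \<gamma> + y \<gamma>\<bar> \<ge> \<epsilon>} \<subseteq> {\<gamma>. \<bar>x \<gamma>\<bar> \<ge> \<epsilon> / 2} \<union> {\<gamma>. \<bar>y \<gamma>\<bar> \<ge> \<epsilon> / 2}"
    by (smt (verit) Collect_mono_iff Un_def field_sum_of_halves mem_Collect_eq)
  show "finite ({\<gamma>. \<bar>x \<gamma>\<bar> \<ge> \<epsilon> / 2} \<union> {\<gamma>. \<bar>y \<gamma>\<bar> \<ge> \<epsilon> / 2})"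
    using assms(1,2)[rule_format, OF half_gt_zero[OF assms(3)]] by (rule finite_UnI)
qed

lemma null_fun_scale:
  fixes x :: "'g \<Rightarrow> real"
  assumes "\<forall>\<epsilon>>0. finite {\<gamma>. \<bar>x \<gamma>\<bar> \<ge> \<epsilon>}" "\<epsilon> > 0"
  shows "finite {\<gamma>. \<bar>c * x \<gamma>\<bar> \<ge> \<epsilon>}"
proof (cases "c = 0")
  case False
  have "{\<gamma>. \<bar>c * x \<gamma>\<bar> \<ge> \<epsilon>} = {\<gamma>. \<bar>x \<gamma>\<bar> \<ge> \<epsilon> / \<bar>c\<bar>}"
    using False by (auto simp: abs_mult field_simps)
  then show ?thesis using assms False by simp
qed (use assms in auto)

lemma null_fun_bdd:
  fixes x :: "'g \<Rightarrow> real"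
  assumes "\<forall>\<epsilon>>0. finite {\<gamma>. \<bar>x \<gamma>\<bar> \<ge> \<epsilon>}"
  shows "bdd_above (range (\<lambda>\<gamma>. \<bar>x \<gamma>\<bar>))"
proof -
  have "finite {\<gamma>. \<bar>x \<gamma>\<bar> \<ge> 1}" using assms by simp
  then have "bdd_above ((\<lambda>\<gamma>. \<bar>x \<gamma>\<bar>) ` {\<gamma>. \<bar>x \<gamma>\<bar> \<ge> 1} \<union> {..1})" by simp
  then show ?thesis by (rule bdd_above_mono) auto
qed

lemma null_norm_add:
  fixes x y :: "'g \<Rightarrow> real"
  assumes "\<forall>\<epsilon>>0. finite {\<gamma>. \<bar>x \<gamma>\<bar> \<ge> \<epsilon>}" "\<forall>\<epsilon>>0. finite {\<gamma>. \<bar>y \<gamma>\<bar> \<ge> \<epsilon>}"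
  shows "(SUP \<gamma>. \<bar>x \<gamma> + y \<gamma>\<bar>) \<le> (SUP \<gamma>. \<bar>x \<gamma>\<bar>) + (SUP \<gamma>. \<bar>y \<gamma>\<bar>)"
proof (rule cSUP_least)
  fix \<gamma>
  show "\<bar>x \<gamma> + y \<gamma>\<bar> \<le> (SUP \<gamma>. \<bar>x \<gamma>\<bar>) + (SUP \<gamma>. \<bar>y \<gamma>\<bar>)"
    using cSUP_upper[OF UNIV_I null_fun_bdd[OF assms(1)], of \<gamma>]
      cSUP_upper[OF UNIV_I null_fun_bdd[OF assms(2)], of \<gamma>] by linarith
qed simp

lemma null_norm_scale:
  fixes x :: "'g \<Rightarrow> real"
  assumes x: "\<forall>\<epsilon>>0. finite {\<gamma>. \<bar>x \<gamma>\<bar> \<ge> \<epsilon>}"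
  shows "(SUP \<gamma>. \<bar>a * x \<gamma>\<bar>) = \<bar>a\<bar> * (SUP \<gamma>. \<bar>x \<gamma>\<bar>)"
proof (rule antisym)
  show "(SUP \<gamma>. \<bar>a * x \<gamma>\<bar>) \<le> \<bar>a\<bar> * (SUP \<gamma>. \<bar>x \<gamma>\<bar>)"
    by (rule cSUP_least)
      (auto simp: abs_mult intro!: mult_left_mono cSUP_upper[OF UNIV_I null_fun_bdd[OF x]])
  show "\<bar>a\<bar> * (SUP \<gamma>. \<bar>x \<gamma>\<bar>) \<le> (SUP \<gamma>. \<bar>a * x \<gamma>\<bar>)"
  proof (cases "a = 0")
    case False
    have bax: "bdd_above (range (\<lambda>\<gamma>. \<bar>a * x \<gamma>\<bar>))"
      by (rule null_fun_bdd) (use null_fun_scale[OF x] in blast)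
    have "(SUP \<gamma>. \<bar>x \<gamma>\<bar>) \<le> (SUP \<gamma>. \<bar>a * x \<gamma>\<bar>) / \<bar>a\<bar>"
    proof (rule cSUP_least)
      fix \<gamma>
      show "\<bar>x \<gamma>\<bar> \<le> (SUP \<gamma>. \<bar>a * x \<gamma>\<bar>) / \<bar>a\<bar>"
        using cSUP_upper[OF UNIV_I bax, of \<gamma>] False
        by (simp add: pos_le_divide_eq abs_mult mult.commute)
    qed simp
    then show ?thesis
      using False by (simp add: pos_le_divide_eq mult.commute)
  qed simp
qed

lemma null_norm_eq_0:
  fixes x :: "'g \<Rightarrow> real"
  assumes x: "\<forall>\<epsilon>>0. finite {\<gamma>. \<bar>x \<gamma>\<bar> \<ge> \<epsilon>}"
  shows "(SUP \<gamma>. \<bar>x \<gamma>\<bar>) = 0 \<longleftrightarrow> x = (\<lambda>_. 0)"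
proof
  assume "(SUP \<gamma>. \<bar>x \<gamma>\<bar>) = 0"
  then have "\<bar>x \<gamma>\<bar> \<le> 0" for \<gamma>
    using cSUP_upper[OF UNIV_I null_fun_bdd[OF x], of \<gamma>] by simp
  then show "x = (\<lambda>_. 0)" by auto
qed simp

instantiation null_fun :: (type) real_normed_vector
begin

lift_definition zero_null_fun :: "'a null_fun" is "\<lambda>_. 0" by auto

lift_definition plus_null_fun :: "'a null_fun \<Rightarrow> 'a null_fun \<Rightarrow> 'a null_fun"
  is "\<lambda>x y \<gamma>. x \<gamma> + y \<gamma>"
  by (blast intro: null_fun_add)

lift_definition uminus_null_fun :: "'a null_fun \<Rightarrow> 'a null_fun" is "\<lambda>x \<gamma>. - x \<gamma>" by simp

definition minus_null_fun :: "'a null_fun \<Rightarrow> 'a null_fun \<Rightarrow> 'a null_fun" where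
  "minus_null_fun x y = x + - y"

lift_definition scaleR_null_fun :: "real \<Rightarrow> 'a null_fun \<Rightarrow> 'a null_fun" is "\<lambda>c x \<gamma>. c * x \<gamma>"
  by (blast intro: null_fun_scale)

lift_definition norm_null_fun :: "'a null_fun \<Rightarrow> real" is "\<lambda>x. SUP \<gamma>. \<bar>x \<gamma>\<bar>" .

definition dist_null_fun :: "'a null_fun \<Rightarrow> 'a null_fun \<Rightarrow> real" where
  "dist_null_fun x y = norm (x - y)"

definition uniformity_null_fun :: "('a null_fun \<times> 'a null_fun) filter" where
  "uniformity_null_fun = (INF e\<in>{0<..}. principal {(x, y). dist x y < e})"

definition open_null_fun :: "'a null_fun set \<Rightarrow> bool" where
  "open_null_fun U \<longleftrightarrow> (\<forall>x\<in>U. \<forall>\<^sub>F (x', y) in uniformity. x' = x \<longrightarrow> y \<in> U)"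

definition sgn_null_fun :: "'a null_fun \<Rightarrow> 'a null_fun" where
  "sgn_null_fun x = inverse (norm x) *\<^sub>R x"

instance
proof
  fix a b :: real and x y z :: "'a null_fun" and U :: "'a null_fun set"
  show "x + y + z = x + (y + z)" by transfer (simp add: add.assoc)
  show "x + y = y + x" by transfer (simp add: add.commute)
  show "0 + x = x" by transfer simp
  show "- x + x = 0" by transfer simp
  show "x - y = x + - y" by (rule minus_null_fun_def)
  show "a *\<^sub>R (x + y) = a *\<^sub>R x + a *\<^sub>R y" by transfer (simp add: distrib_left)
  show "(a + b) *\<^sub>R x = a *\<^sub>R x + b *\<^sub>R x" by transfer (simp add: distrib_right)
  show "a *\<^sub>R b *\<^sub>R x = (a * b) *\<^sub>R x" by transfer (simp add: mult.assoc)
  show "1 *\<^sub>R x = x" by transfer simp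
  show "dist x y = norm (x - y)" by (rule dist_null_fun_def)
  show "sgn x = inverse (norm x) *\<^sub>R x" by (rule sgn_null_fun_def)
  show "(uniformity :: ('a null_fun \<times> 'a null_fun) filter)
      = (INF e\<in>{0<..}. principal {(x, y). dist x y < e})"
    by (rule uniformity_null_fun_def)
  show "open U \<longleftrightarrow> (\<forall>x\<in>U. \<forall>\<^sub>F (x', y) in uniformity. x' = x \<longrightarrow> y \<in> U)"
    by (rule open_null_fun_def)
  show "norm (x + y) \<le> norm x + norm y"
    by transfer (auto intro: null_norm_add)
  show "norm (a *\<^sub>R x) = \<bar>a\<bar> * norm x"
    by transfer (auto intro: null_norm_scale)
  show "norm x = 0 \<longleftrightarrow> x = 0"
    by transfer (auto simp: null_norm_eq_0)
qed

end

(* A function on the set \<Gamma> is encoded by its extension by 0 to the whole type, so that the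
   supremum over the type in the norm is the supremum over \<Gamma>. *)
definition c0 :: "'g set \<Rightarrow> 'g null_fun set" where
  "c0 \<Gamma> = {x. \<forall>\<gamma>. \<gamma> \<notin> \<Gamma> \<longrightarrow> null_apply x \<gamma> = 0}"

lemma subspace_c0: "subspace (c0 \<Gamma>)"
  by (rule subspaceI)
    (auto simp: c0_def zero_null_fun.rep_eq plus_null_fun.rep_eq scaleR_null_fun.rep_eq)

(* Meant for linear subspaces V and W of the ambient normed spaces. *)
definition isometrically_isomorphic ::
    "'a :: real_normed_vector set \<Rightarrow> 'b :: real_normed_vector set \<Rightarrow> bool" where
  "isometrically_isomorphic V W \<longleftrightarrow>
     (\<exists>T. bij_betw T V W
        \<and> (\<forall>x\<in>V. \<forall>y\<in>V. T (x + y) = T x + T y)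
        \<and> (\<forall>c. \<forall>x\<in>V. T (c *\<^sub>R x) = c *\<^sub>R T x)
        \<and> (\<forall>x\<in>V. norm (T x) = norm x))"

definition dense_subset :: "'a :: topological_space set \<Rightarrow> 'a set \<Rightarrow> bool" where
  "dense_subset D N \<longleftrightarrow> D \<subseteq> N \<and> N \<subseteq> closure D"

(* Cardinals are represented by sets up to equipollence: the least cardinality of a dense
   subset of N is that of \<Gamma>. *)
definition has_dens :: "'a :: topological_space set \<Rightarrow> 'g set \<Rightarrow> bool" where
  "has_dens N \<Gamma> \<longleftrightarrow>
     (\<exists>D. dense_subset D N \<and> |D| =o |\<Gamma>| ) \<and> (\<forall>D. dense_subset D N \<longrightarrow> |\<Gamma>| \<le>o |D| )"

definition cluster_points :: "'a :: topological_space set" where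
  "cluster_points = {x. x islimpt UNIV}"

end

theory Submission
  imports Defs
begin

text \<open>Every metric space contains a discrete subset at least as large as its density character. To
  reach it even when the density character has countable cofinality, take a maximal disjoint family
  of open sets that are homogeneous, in that all their nonempty open subsets have the same density
  character; the union of the family is dense, so it suffices to treat each member. An infinite
  homogeneous set has a dense union of discrete sets \<open>D n\<close>, and contains disjoint open sets \<open>U n\<close>;
  unless some \<open>D n\<close> is already large enough, each \<open>U n\<close> contains a discrete set of cardinality
  at least that of \<open>D n\<close>.

  Applied to the set of cluster points, this yields points \<open>p \<gamma>\<close> and radii \<open>r \<gamma>\<close> for \<open>\<gamma> \<in> \<Gamma>\<close> with
  \<open>r \<gamma> + r \<delta> \<le> dist (p \<gamma>) (p \<delta>)\<close>. The cones \<open>max 0 (r \<gamma> - dist (p \<gamma>) x)\<close>, combined with null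
  coefficients and shifted to vanish at the base point, form the required copy of \<open>c\<^sub>0\<close>: the
  condition on the radii bounds the norm of a combination by the supremum of its coefficients, this
  supremum is a maximum because the coefficients are null, and the slope of each cone is attained
  between \<open>p \<gamma>\<close> and any point near it, which exists as \<open>p \<gamma>\<close> is a cluster point.\<close>

section \<open>Discrete subsets of maximal cardinality\<close>

text \<open>Zorn's lemma, used below for separated points and again for disjoint open sets.
  \<open>R\<close> may be asymmetric, so a rejected point may violate it in either order of the
  arguments.\<close>

lemma maximal_pairwise_subset:
  obtains F where "F \<subseteq> X" "pairwise R F"
    "\<And>x. x \<in> X \<Longrightarrow> x \<notin> F \<Longrightarrow> \<exists>y\<in>F. \<not> (R x y \<and> R y x)"
proof -
  have "\<exists>M\<in>{F. F \<subseteq> X \<and> pairwise R F}. \<forall>G\<in>{F. F \<subseteq> X \<and> pairwise R F}. M \<subseteq> G \<longrightarrow> G = M"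
  proof (rule subset_Zorn')
    fix C assume C: "subset.chain {F. F \<subseteq> X \<and> pairwise R F} C"
    then have "\<forall>F\<in>C. F \<subseteq> X \<and> pairwise R F"
      by (auto simp: subset_chain_def)
    moreover from C have "\<forall>F\<in>C. \<forall>G\<in>C. F \<subseteq> G \<or> G \<subseteq> F"
      by (auto simp: subset_chain_def)
    ultimately show "\<Union>C \<in> {F. F \<subseteq> X \<and> pairwise R F}"
      by (auto simp: pairwise_def) (metis subsetD)+
  qed
  then obtain F where F: "F \<subseteq> X" "pairwise R F"
    and max: "\<And>G. G \<subseteq> X \<Longrightarrow> pairwise R G \<Longrightarrow> F \<subseteq> G \<Longrightarrow> G = F"
    by auto
  have "\<exists>y\<in>F. \<not> (R x y \<and> R y x)" if "x \<in> X" "x \<notin> F" for x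
    using F max[of "insert x F"] that by (auto simp: pairwise_insert)
  with F that show thesis by blast
qed

lemma discrete_finite:
  fixes A :: "'a :: t1_space set"
  assumes "finite A"
  shows "discrete A"
  unfolding discrete_def isolated_in_islimpt_iff using assms islimpt_finite by blast

text \<open>A neighbourhood isolating a point in its own \<open>A i\<close> is intersected with an
  open set that cuts \<open>U i\<close> out of \<open>N\<close>; this keeps out the other
  members.\<close>

lemma discrete_UN_openin:
  assumes "\<And>i. i \<in> I \<Longrightarrow> discrete (A i)" "\<And>i. i \<in> I \<Longrightarrow> A i \<subseteq> U i"
    and "\<And>i. i \<in> I \<Longrightarrow> openin (top_of_set N) (U i)" "disjoint_family_on U I"
  shows "discrete (\<Union>i\<in>I. A i)"
proof (rule discreteI)
  fix x assume "x \<in> (\<Union>i\<in>I. A i)"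
  then obtain i where i: "i \<in> I" "x \<in> A i" by blast
  then obtain T where T: "open T" "T \<inter> A i = {x}"
    using assms(1) by (meson discreteD isolated_inE)
  obtain W where W: "open W" "U i = N \<inter> W"
    using assms(3)[OF i(1)] by (auto simp: openin_open)
  have "T \<inter> W \<inter> (\<Union>i\<in>I. A i) = {x}"
  proof (intro equalityI subsetI)
    fix y assume y: "y \<in> T \<inter> W \<inter> (\<Union>i\<in>I. A i)"
    then obtain j where j: "j \<in> I" "y \<in> A j" by blast
    then have "y \<in> U j" "y \<in> N"
      using assms(2,3) openin_imp_subset by blast+
    then have "j = i"
      using y W j(1) i(1) assms(4) by (auto simp: disjoint_family_on_def)
    then show "y \<in> {x}" using j y T by blast
  next
    fix y assume "y \<in> {x}"
    then show "y \<in> T \<inter> W \<inter> (\<Union>i\<in>I. A i)"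
      using i T W assms(2) by blast
  qed
  then show "x isolated_in (\<Union>i\<in>I. A i)"
    using i T W by (intro isolated_inI[of _ _ "T \<inter> W"]) auto
qed

text \<open>The \<open>D i\<close> may overlap, so each point of their union first picks one index
  and is then mapped by the injection for that index. Disjointness of the \<open>A i\<close>
  recovers the index from the image.\<close>

lemma card_of_UN_mono_disjoint:
  assumes le: "\<And>i. i \<in> I \<Longrightarrow> |D i| \<le>o |A i|" and disj: "disjoint_family_on A I"
  shows "|\<Union>i\<in>I. D i| \<le>o |\<Union>i\<in>I. A i|"
proof -
  have "\<forall>i\<in>I. \<exists>f. inj_on f (D i) \<and> f ` D i \<subseteq> A i"
    using le by (simp add: card_of_ordLeq)
  then obtain f where f: "\<And>i. i \<in> I \<Longrightarrow> inj_on (f i) (D i)" "\<And>i. i \<in> I \<Longrightarrow> f i ` D i \<subseteq> A i"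
    by metis
  have "\<forall>x\<in>(\<Union>i\<in>I. D i). \<exists>i\<in>I. x \<in> D i" by blast
  then obtain k where k: "\<And>x. x \<in> (\<Union>i\<in>I. D i) \<Longrightarrow> k x \<in> I \<and> x \<in> D (k x)"
    by metis
  have "inj_on (\<lambda>x. f (k x) x) (\<Union>i\<in>I. D i)"
  proof (rule inj_onI)
    fix x y assume x: "x \<in> (\<Union>i\<in>I. D i)" and y: "y \<in> (\<Union>i\<in>I. D i)"
      and eq: "f (k x) x = f (k y) y"
    have "f (k x) x \<in> A (k x)" "f (k y) y \<in> A (k y)"
      using k[OF x] k[OF y] f(2) by blast+
    then have "k x = k y"
      using eq disj k[OF x] k[OF y] by (auto simp: disjoint_family_on_def)
    then show "x = y"
      using eq k[OF x] k[OF y] f(1) by (metis inj_onD)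
  qed
  moreover have "(\<lambda>x. f (k x) x) ` (\<Union>i\<in>I. D i) \<subseteq> (\<Union>i\<in>I. A i)"
    using k f(2) by blast
  ultimately show ?thesis
    using card_of_ordLeq by blast
qed

text \<open>A maximal set of points with mutual distances at least 1/(n+1) is discrete, and by
  maximality every point of \<open>S\<close> is closer than that to some member.\<close>

lemma dense_sequence_of_discrete:
  fixes S :: "'a :: metric_space set"
  obtains D :: "nat \<Rightarrow> 'a set"
  where "\<And>n. discrete (D n)" "\<And>n. D n \<subseteq> S" "dense_subset (\<Union>n. D n) S"
proof -
  have "\<exists>D\<subseteq>S. discrete D \<and> (\<forall>x\<in>S. \<exists>y\<in>D. dist y x < inverse (real (Suc n)))" for n
  proof -
    define e where "e = inverse (real (Suc n))"
    have e: "e > 0" by (simp add: e_def)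
    obtain D where D: "D \<subseteq> S" "pairwise (\<lambda>x y. e \<le> dist x y) D"
      "\<And>x. x \<in> S \<Longrightarrow> x \<notin> D \<Longrightarrow> \<exists>y\<in>D. \<not> (e \<le> dist x y \<and> e \<le> dist y x)"
      by (rule maximal_pairwise_subset[of S "\<lambda>x y. e \<le> dist x y"]) blast
    have "discrete D"
      unfolding discrete_def isolated_in_dist_Ex_iff
      using D(2) e by (metis linorder_not_le pairwiseD)
    moreover have "\<exists>y\<in>D. dist y x < e" if "x \<in> S" for x
      using D(3)[OF that] e by (cases "x \<in> D") (auto simp: dist_commute not_le intro: bexI[of _ x])
    ultimately show ?thesis
      using D(1) unfolding e_def by blast
  qed
  then obtain D where D: "\<And>n. D n \<subseteq> S" "\<And>n. discrete (D n)"
    "\<And>n x. x \<in> S \<Longrightarrow> \<exists>y\<in>D n. dist y x < inverse (real (Suc n))"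
    by metis
  have "x \<in> closure (\<Union>n. D n)" if "x \<in> S" for x
    unfolding closure_approachable
  proof (intro allI impI)
    fix e :: real assume "e > 0"
    then obtain n where "inverse (real (Suc n)) < e"
      using reals_Archimedean by blast
    then show "\<exists>y\<in>\<Union>n. D n. dist y x < e"
      using D(3)[OF that, of n] by (meson UN_I UNIV_I less_trans)
  qed
  then show thesis
    using D(1,2) by (intro that) (auto simp: dense_subset_def)
qed

text \<open>Take two points at distance \<open>d\<close>. If infinitely many points lie in the
  \<open>d/2\<close> ball around the first, a ball around the second is split off; otherwise a ball
  around the first is.\<close>

lemma infinite_open_split:
  fixes S :: "'a :: metric_space set"
  assumes "open W" "infinite (W \<inter> S)"
  shows "\<exists>V W'. open V \<and> open W' \<and> V \<subseteq> W \<and> W' \<subseteq> W \<and> V \<inter> W' = {} \<and> V \<inter> S \<noteq> {} \<and> infinite (W' \<inter> S)"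
proof -
  obtain a where a: "a \<in> W \<inter> S"
    using infinite_imp_nonempty[OF assms(2)] by blast
  obtain b where b: "b \<in> W \<inter> S" "b \<noteq> a"
    using infinite_imp_nonempty[OF infinite_remove[OF assms(2), of a]] by blast
  define d where "d = dist a b"
  have d: "d > 0" using b by (simp add: d_def)
  show ?thesis
  proof (cases "infinite ((W \<inter> ball a (d/2)) \<inter> S)")
    case True
    have "(W \<inter> ball b (d/2)) \<inter> (W \<inter> ball a (d/2)) = {}"
      using dist_triangle_half_l[of a _ d b] by (auto simp: d_def dist_commute)
    moreover have "(W \<inter> ball b (d/2)) \<inter> S \<noteq> {}"
      using b d by auto
    ultimately show ?thesis
      using True assms(1) by (intro exI[of _ "W \<inter> ball b (d/2)"] exI[of _ "W \<inter> ball a (d/2)"]) auto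
  next
    case False
    \<comment> \<open>The radius drops from \<open>d/2\<close> to \<open>d/3\<close> so that the
      larger open ball and the complement of the smaller closed ball overlap and together cover
      \<open>W\<close>.\<close>
    have "W \<inter> S \<subseteq> (W \<inter> ball a (d/2)) \<inter> S \<union> (W - cball a (d/3)) \<inter> S"
      using d by auto
    then have "infinite ((W - cball a (d/3)) \<inter> S)"
      using False assms(2) by (meson finite_Un finite_subset)
    moreover have "(W \<inter> ball a (d/3)) \<inter> S \<noteq> {}"
      using a d by auto
    ultimately show ?thesis
      using assms(1)
      by (intro exI[of _ "W \<inter> ball a (d/3)"] exI[of _ "W - cball a (d/3)"]) (auto simp: open_Diff)
  qed
qed

lemma infinite_disjoint_open_sequence:
  fixes S :: "'a :: metric_space set"
  assumes "infinite S"
  obtains U :: "nat \<Rightarrow> 'a set"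
  where "disjoint_family U" "\<And>n. openin (top_of_set S) (U n)" "\<And>n. U n \<noteq> {}"
proof -
  \<comment> \<open>In a pair, \<open>V\<close> is the piece just split off and \<open>W\<close> the
    remainder, which keeps infinitely many points of \<open>S\<close>. Later pieces are taken inside
    \<open>W\<close> and hence miss \<open>V\<close>.\<close>
  define P where "P = (\<lambda>(V, W). open V \<and> open W \<and> V \<inter> W = {} \<and> V \<inter> S \<noteq> {} \<and> infinite (W \<inter> S))"
  define Q where "Q = (\<lambda>(V :: 'a set, W) (V', W'). V' \<subseteq> W \<and> W' \<subseteq> (W :: 'a set))"
  have "\<exists>f. \<forall>n. P (f n) \<and> Q (f n) (f (Suc n))"
  proof (rule dependent_nat_choice)
    show "\<exists>x. P x"
      using infinite_open_split[of UNIV S] assms by (auto simp: P_def)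
    show "\<exists>y. P y \<and> Q x y" if "P x" for x n
      using that infinite_open_split[of "snd x" S]
      by (simp add: P_def Q_def case_prod_beta) blast
  qed
  then obtain f where f: "\<And>n. P (f n)" "\<And>n. Q (f n) (f (Suc n))"
    by blast
  have Wle: "snd (f n) \<subseteq> snd (f m)" if "m \<le> n" for m n
    using that by (rule lift_Suc_antimono_le[rotated]) (use f(2) in \<open>auto simp: Q_def case_prod_beta\<close>)
  have disj: "fst (f m) \<inter> fst (f n) = {}" if lt: "m < n" for m n
  proof -
    obtain k where k: "n = Suc k" "m \<le> k"
      using lt by (cases n) (auto simp: less_Suc_eq_le)
    have "fst (f n) \<subseteq> snd (f m)"
      using f(2)[of k] Wle[OF k(2)] k(1) by (auto simp: Q_def case_prod_beta)
    then show ?thesis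
      using f(1)[of m] by (auto simp: P_def case_prod_beta)
  qed
  show thesis
  proof
    show "disjoint_family (\<lambda>n. S \<inter> fst (f n))"
      unfolding disjoint_family_on_def using disj by (fastforce simp: neq_iff)
    show "openin (top_of_set S) (S \<inter> fst (f n))" for n
      using f(1)[of n] by (auto simp: P_def case_prod_beta)
    show "S \<inter> fst (f n) \<noteq> {}" for n
      using f(1)[of n] by (auto simp: P_def case_prod_beta)
  qed
qed

section \<open>Homogeneous sets and exhaustion by them\<close>

lemma homogeneous_discrete_subset:
  fixes S :: "'a :: metric_space set"
  assumes E: "dense_subset E S"
    and hom: "\<And>V E'. openin (top_of_set S) V \<Longrightarrow> V \<noteq> {} \<Longrightarrow> dense_subset E' V \<Longrightarrow> |E| \<le>o |E'|"
  shows "\<exists>A\<subseteq>S. discrete A \<and> |E| \<le>o |A|"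
proof (cases "finite E")
  case True
  then have "E \<subseteq> S" "discrete E"
    using E discrete_finite by (auto simp: dense_subset_def)
  then show ?thesis using card_of_mono1[OF order_refl] by blast
next
  case False
  obtain D :: "nat \<Rightarrow> 'a set"
    where D: "\<And>n. discrete (D n)" "\<And>n. D n \<subseteq> S" "dense_subset (\<Union>n. D n) S"
    by (rule dense_sequence_of_discrete[of S]) blast
  have infS: "infinite S"
    using False E by (auto simp: dense_subset_def dest: finite_subset)
  obtain U :: "nat \<Rightarrow> 'a set" where U: "disjoint_family U"
    "\<And>n. openin (top_of_set S) (U n)" "\<And>n. U n \<noteq> {}"
    by (rule infinite_disjoint_open_sequence[OF infS]) blast
  show ?thesis
  proof (cases "\<exists>n. |E| \<le>o |D n|")
    case True
    then show ?thesis using D by blast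
  next
    case small: False
    \<comment> \<open>Each \<open>D n\<close> is matched in size inside its own \<open>U n\<close>,
      so that the matches are disjoint and their union stays discrete.\<close>
    have "\<exists>A\<subseteq>U n. discrete A \<and> |D n| \<le>o |A|" for n
    proof (cases "finite (D n)")
      case True
      \<comment> \<open>\<open>U n\<close> is dense in itself, so homogeneity makes it at least as
        large as the infinite set \<open>E\<close>.\<close>
      have "infinite (U n)"
      proof
        assume fin: "finite (U n)"
        have "|E| \<le>o |U n|"
          using U by (intro hom[of "U n"]) (auto simp: dense_subset_def closure_subset)
        then show False
          using fin \<open>infinite E\<close> card_of_ordLeq_finite by blast
      qed
      then obtain A where A: "A \<subseteq> U n" "finite A" "card A = card (D n)"
        by (meson infinite_arbitrarily_large)
      then have "|D n| \<le>o |A|"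
        using True by (metis card_of_ordLeq finite_same_card_bij bij_betw_def order_refl)
      then show ?thesis using A discrete_finite by blast
    next
      case inf: False
      obtain C :: "nat \<Rightarrow> 'a set"
        where C: "\<And>k. discrete (C k)" "\<And>k. C k \<subseteq> U n" "dense_subset (\<Union>k. C k) (U n)"
        by (rule dense_sequence_of_discrete[of "U n"]) blast
      \<comment> \<open>Otherwise the countable union of the \<open>C k\<close> would have at most
        the infinite cardinality of \<open>D n\<close>. It is dense in \<open>U n\<close>, so
        homogeneity would make \<open>D n\<close> as large as \<open>E\<close>, against
        \<open>small\<close>.\<close>
      have "\<exists>k. |D n| \<le>o |C k|"
      proof (rule ccontr)
        assume "\<nexists>k. |D n| \<le>o |C k|"
        then have "\<forall>k\<in>UNIV. |C k| \<le>o |D n|"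
          using ordLeq_total[OF card_of_Well_order card_of_Well_order] by blast
        then have "|\<Union>k. C k| \<le>o |D n|"
          by (rule card_of_UNION_ordLeq_infinite[OF inf infinite_iff_card_of_nat[THEN iffD1, OF inf]])
        moreover have "|E| \<le>o |\<Union>k. C k|"
          by (rule hom[OF U(2,3) C(3)])
        ultimately have "|E| \<le>o |D n|"
          by (rule ordLeq_transitive[rotated])
        with small show False by blast
      qed
      then show ?thesis using C by blast
    qed
    then obtain A where A: "\<And>n. A n \<subseteq> U n" "\<And>n. discrete (A n)" "\<And>n. |D n| \<le>o |A n|"
      by metis
    have "disjoint_family A"
      using U(1) A(1) by (rule disjoint_family_subset)
    then have "|\<Union>n. D n| \<le>o |\<Union>n. A n|"
      using A(3) by (intro card_of_UN_mono_disjoint)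
    moreover have "|E| \<le>o |\<Union>n. D n|"
      using D(3) infS by (intro hom[of S]) auto
    ultimately have "|E| \<le>o |\<Union>n. A n|"
      by (rule ordLeq_transitive[rotated])
    moreover have "discrete (\<Union>n. A n)"
      by (rule discrete_UN_openin[where U = U and N = S]) (use A U in auto)
    moreover have "(\<Union>n. A n) \<subseteq> S"
      using A(1) U(2) openin_imp_subset by blast
    ultimately show ?thesis by blast
  qed
qed

text \<open>Cardinals are well-ordered, so among all dense subsets of nonempty open pieces of
  \<open>W\<close> one has least cardinality. Open pieces of its piece are again open in
  \<open>W\<close> and cannot do better.\<close>

lemma exists_homogeneous_open_subset:
  fixes W :: "'a :: metric_space set"
  assumes "W \<noteq> {}"
  obtains V E where "openin (top_of_set W) V" "V \<noteq> {}" "dense_subset E V"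
    "\<And>V' E'. openin (top_of_set V) V' \<Longrightarrow> V' \<noteq> {} \<Longrightarrow> dense_subset E' V' \<Longrightarrow> |E| \<le>o |E'|"
proof -
  define R where "R = {|E| | E V. openin (top_of_set W) V \<and> V \<noteq> {} \<and> dense_subset E V}"
  have "\<exists>r\<in>R. \<forall>r'\<in>R. r \<le>o r'"
  proof (rule exists_minim_Card_order)
    have "|W| \<in> R"
      using assms unfolding R_def dense_subset_def by (blast intro: closure_subset[THEN subsetD])
    then show "R \<noteq> {}" by blast
    show "\<forall>r\<in>R. Card_order r" by (auto simp: R_def card_of_Card_order)
  qed
  then obtain V E where V: "openin (top_of_set W) V" "V \<noteq> {}" "dense_subset E V"
    and min: "\<forall>r'\<in>R. |E| \<le>o r'"
    unfolding R_def by blast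
  have "|E| \<le>o |E'|" if "openin (top_of_set V) V'" "V' \<noteq> {}" "dense_subset E' V'" for V' E'
    using min that openin_trans[OF that(1) V(1)] unfolding R_def by blast
  with V that show thesis by blast
qed

text \<open>Comparing \<open>A\<close> with some dense \<open>E\<close> suffices, since the density
  character is at most the cardinality of \<open>E\<close>.\<close>

theorem exists_discrete_subset_card_dense:
  fixes N :: "'a :: metric_space set"
  obtains A E where "A \<subseteq> N" "discrete A" "dense_subset E N" "|E| \<le>o |A|"
proof -
  define good where "good V = (\<exists>A E. A \<subseteq> V \<and> discrete A \<and> dense_subset E V \<and> |E| \<le>o |A| )"
    for V :: "'a set"
  define X where "X = {V. openin (top_of_set N) V \<and> V \<noteq> {} \<and> good V}"
  obtain F where F: "F \<subseteq> X" "pairwise disjnt F"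
    and max: "\<And>V. V \<in> X \<Longrightarrow> V \<notin> F \<Longrightarrow> \<exists>W\<in>F. \<not> (disjnt V W \<and> disjnt W V)"
    using maximal_pairwise_subset[of X disjnt] by metis
  have opF: "openin (top_of_set N) V" if "V \<in> F" for V
    using F(1) that by (auto simp: X_def)
  have "\<forall>V\<in>F. \<exists>A E. A \<subseteq> V \<and> discrete A \<and> dense_subset E V \<and> |E| \<le>o |A|"
    using F(1) by (auto simp: X_def good_def)
  then obtain A E where AE: "\<And>V. V \<in> F \<Longrightarrow> A V \<subseteq> V" "\<And>V. V \<in> F \<Longrightarrow> discrete (A V)"
    "\<And>V. V \<in> F \<Longrightarrow> dense_subset (E V) V" "\<And>V. V \<in> F \<Longrightarrow> |E V| \<le>o |A V|"
    by metis
  have disjF: "disjoint_family_on (\<lambda>V. V) F"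
    using F(2) by (auto simp: disjoint_family_on_def pairwise_def disjnt_def)
  show thesis
  proof
    show "(\<Union>V\<in>F. A V) \<subseteq> N"
      using AE(1) opF openin_imp_subset by blast
    show "discrete (\<Union>V\<in>F. A V)"
      by (rule discrete_UN_openin[where U = "\<lambda>V. V"]) (use AE opF disjF in auto)
    have "disjoint_family_on A F"
      using disjF AE(1) unfolding disjoint_family_on_def by blast
    then show "|\<Union>V\<in>F. E V| \<le>o |\<Union>V\<in>F. A V|"
      using AE(4) by (intro card_of_UN_mono_disjoint)
    \<comment> \<open>\<open>W\<close> is the part of \<open>N\<close> that the chosen dense sets do
      not approximate. If nonempty, it would contain a homogeneous piece, which is
      \<open>good\<close> and disjoint from every member of \<open>F\<close>, against
      maximality.\<close>
    define W where "W = N - closure (\<Union>V\<in>F. E V)"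
    have opW: "openin (top_of_set N) W"
      by (simp add: W_def Diff_eq openin_open_Int open_Compl)
    have "W = {}"
    proof (rule ccontr)
      assume "W \<noteq> {}"
      then obtain V E' where V: "openin (top_of_set W) V" "V \<noteq> {}" "dense_subset E' V"
        and "\<And>V' E''. openin (top_of_set V) V' \<Longrightarrow> V' \<noteq> {} \<Longrightarrow> dense_subset E'' V' \<Longrightarrow> |E'| \<le>o |E''|"
        using exists_homogeneous_open_subset[of W] by metis
      then have "good V"
        unfolding good_def using homogeneous_discrete_subset[of E' V] by blast
      then have VX: "V \<in> X"
        using V openin_trans[OF V(1) opW] by (auto simp: X_def)
      have dis: "V \<inter> V' = {}" if "V' \<in> F" for V'
      proof -
        have "V' \<subseteq> closure (\<Union>V\<in>F. E V)"
          using AE(3)[OF that] closure_mono[of "E V'" "\<Union>V\<in>F. E V"] that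
          by (auto simp: dense_subset_def)
        then show ?thesis
          using openin_imp_subset[OF V(1)] by (auto simp: W_def)
      qed
      then have "V \<notin> F" using V(2) by blast
      with max[OF VX] dis show False by (auto simp: disjnt_def)
    qed
    then show "dense_subset (\<Union>V\<in>F. E V) N"
      using AE(3) opF openin_imp_subset unfolding W_def dense_subset_def by blast
  qed
qed

section \<open>Combinations of disjointly supported bumps\<close>

lemma abs_null_apply_le_norm: "\<bar>null_apply c \<gamma>\<bar> \<le> norm c"
proof -
  have "bdd_above (range (\<lambda>\<gamma>. \<bar>null_apply c \<gamma>\<bar>))"
    using null_apply[of c] by (intro null_fun_bdd) simp
  then show ?thesis
    unfolding norm_null_fun.rep_eq by (rule cSUP_upper[OF UNIV_I])
qed

text \<open>If the norm is positive, only finitely many coefficients reach half of it, and the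
  largest of these dominates all the others.\<close>

lemma c0_norm_attained:
  assumes "c \<in> c0 \<Gamma>" "\<Gamma> \<noteq> {}"
  obtains \<gamma> where "\<gamma> \<in> \<Gamma>" "norm c = \<bar>null_apply c \<gamma>\<bar>"
proof (cases "norm c = 0")
  case True
  obtain \<gamma> where "\<gamma> \<in> \<Gamma>" using assms(2) by blast
  with True show ?thesis
    using that abs_null_apply_le_norm[of c \<gamma>] by simp
next
  case False
  define B where "B = {\<gamma>. \<bar>null_apply c \<gamma>\<bar> \<ge> norm c / 2}"
  have pos: "norm c / 2 > 0" using False by simp
  have "finite B"
    using null_apply[of c] pos unfolding B_def by blast
  have outside: "\<bar>null_apply c \<gamma>\<bar> < norm c / 2" if "\<gamma> \<notin> B" for \<gamma>
    using that by (simp add: B_def)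
  have "B \<noteq> {}"
  proof
    assume "B = {}"
    then have "norm c \<le> norm c / 2"
      unfolding norm_null_fun.rep_eq[of c]
      using outside by (intro cSUP_least) (auto simp: norm_null_fun.rep_eq[of c] less_imp_le)
    then show False using pos by simp
  qed
  then obtain \<gamma> where \<gamma>: "\<gamma> \<in> B" "\<And>\<delta>. \<delta> \<in> B \<Longrightarrow> \<bar>null_apply c \<delta>\<bar> \<le> \<bar>null_apply c \<gamma>\<bar>"
    using obtains_MAX[OF \<open>finite B\<close>, of "\<lambda>\<gamma>. \<bar>null_apply c \<gamma>\<bar>"] \<open>finite B\<close>
    by (metis Max_ge finite_imageI imageI)
  have "\<bar>null_apply c \<delta>\<bar> \<le> \<bar>null_apply c \<gamma>\<bar>" for \<delta>
  proof (cases "\<delta> \<in> B")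
    case False
    then show ?thesis using outside[of \<delta>] \<gamma>(1) by (simp add: B_def)
  qed (rule \<gamma>(2))
  then have "norm c \<le> \<bar>null_apply c \<gamma>\<bar>"
    unfolding norm_null_fun.rep_eq by (intro cSUP_least) auto
  then have "norm c = \<bar>null_apply c \<gamma>\<bar>"
    using abs_null_apply_le_norm[of c \<gamma>] by simp
  \<comment> \<open>This coefficient is nonzero, while \<open>c\<close> vanishes off
    \<open>\<Gamma>\<close>.\<close>
  moreover have "\<gamma> \<in> \<Gamma>"
    using assms(1) \<gamma>(1) pos by (force simp: c0_def B_def)
  ultimately show ?thesis using that by blast
qed

text \<open>The bumps have pairwise disjoint supports, so they are encoded by a single function \<open>h\<close> and
  the function \<open>g\<close> telling which bump a point belongs to; where \<open>h\<close> vanishes, the value of \<open>g\<close>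
  is irrelevant.\<close>

definition bump_sum :: "('a :: pointed_metric_space \<Rightarrow> 'g) \<Rightarrow> ('a \<Rightarrow> real) \<Rightarrow> 'g null_fun \<Rightarrow> 'a lip0" where
  "bump_sum g h c = Abs_lip0 (\<lambda>x. null_apply c (g x) * h x - null_apply c (g basepoint) * h basepoint)"

text \<open>Across two bumps, coefficients of opposite sign add the heights; the last clause keeps
  this sum within the distance, so that the norm does not exceed the supremum of the
  coefficients.\<close>

definition bump_family :: "('a :: metric_space \<Rightarrow> 'g) \<Rightarrow> ('a \<Rightarrow> real) \<Rightarrow> bool" where
  "bump_family g h \<longleftrightarrow> (\<forall>x. 0 \<le> h x) \<and> (\<forall>x y. g x = g y \<longrightarrow> \<bar>h x - h y\<bar> \<le> dist x y)
     \<and> (\<forall>x y. g x \<noteq> g y \<longrightarrow> h x + h y \<le> dist x y)"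

lemma bump_family_lipschitz_bound:
  assumes "bump_family g h"
  shows "\<bar>null_apply c (g x) * h x - null_apply c (g y) * h y\<bar> \<le> norm c * dist x y"
proof (cases "g x = g y")
  case True
  have "\<bar>null_apply c (g x) * h x - null_apply c (g y) * h y\<bar> = \<bar>null_apply c (g x)\<bar> * \<bar>h x - h y\<bar>"
    by (simp add: True right_diff_distrib flip: abs_mult)
  also have "\<dots> \<le> norm c * dist x y"
    using True assms by (intro mult_mono abs_null_apply_le_norm) (auto simp: bump_family_def)
  finally show ?thesis .
next
  case False
  have h: "0 \<le> h x" "0 \<le> h y" "h x + h y \<le> dist x y"
    using False assms by (auto simp: bump_family_def)
  have "\<bar>null_apply c (g x) * h x - null_apply c (g y) * h y\<bar>
      \<le> \<bar>null_apply c (g x)\<bar> * h x + \<bar>null_apply c (g y)\<bar> * h y"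
    using h abs_triangle_ineq4[of "null_apply c (g x) * h x" "null_apply c (g y) * h y"]
    by (simp add: abs_mult)
  also have "\<dots> \<le> norm c * h x + norm c * h y"
    using h by (intro add_mono mult_right_mono abs_null_apply_le_norm)
  also have "\<dots> \<le> norm c * dist x y"
    using h by (simp add: mult_left_mono flip: distrib_left)
  finally show ?thesis .
qed

lemma lip0_apply_bump_sum:
  assumes "bump_family g h"
  shows "lip0_apply (bump_sum g h c) x = null_apply c (g x) * h x - null_apply c (g basepoint) * h basepoint"
proof -
  have "(norm c)-lipschitz_on UNIV (\<lambda>x. null_apply c (g x) * h x - null_apply c (g basepoint) * h basepoint)"
    using bump_family_lipschitz_bound[OF assms] by (intro lipschitz_onI) (auto simp: dist_real_def)
  then show ?thesis
    unfolding bump_sum_def by (subst Abs_lip0_inverse) auto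
qed

lemma linear_bump_sum:
  assumes "bump_family g h"
  shows "linear (bump_sum g h)"
  by (rule linearI; rule lip0_apply_inject[THEN iffD1])
    (auto simp: fun_eq_iff lip0_apply_bump_sum[OF assms] plus_lip0.rep_eq scaleR_lip0.rep_eq
      plus_null_fun.rep_eq scaleR_null_fun.rep_eq algebra_simps)

lemma norm_bump_sum_le:
  assumes "bump_family g h"
  shows "norm (bump_sum g h c) \<le> norm c"
  unfolding norm_lip0.rep_eq[of "bump_sum g h c"]
proof (rule lip_const_least)
  show "\<bar>lip0_apply (bump_sum g h c) y - lip0_apply (bump_sum g h c) x\<bar> \<le> norm c * dist x y" for x y
    using bump_family_lipschitz_bound[OF assms, of c y x]
    by (simp add: lip0_apply_bump_sum[OF assms] dist_commute)
qed simp

lemma lip0_slope_le_norm: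
  "\<bar>lip0_apply f p - lip0_apply f q\<bar> / dist p q \<le> norm f"
proof -
  obtain L where "L-lipschitz_on UNIV (lip0_apply f)"
    using lip0_apply[of f] by blast
  then have "\<bar>lip0_apply f p - lip0_apply f q\<bar> \<le> norm f * dist p q"
    unfolding norm_lip0.rep_eq using lip_const_bound by (metis dist_commute)
  then show ?thesis
    by (cases "p = q") (auto simp: divide_le_eq)
qed

text \<open>On the bump carrying the largest coefficient, the slope between \<open>p\<close> and
  \<open>q\<close> equals \<open>norm c\<close>. This one slope gives both the lower bound for the
  norm and its attainment.\<close>

lemma bump_sum_isometry_SNA:
  assumes bf: "bump_family g h"
    and att: "\<And>\<gamma>. \<gamma> \<in> \<Gamma> \<Longrightarrow> \<exists>p q. p \<noteq> q \<and> g p = \<gamma> \<and> g q = \<gamma> \<and> \<bar>h p - h q\<bar> = dist p q"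
    and c: "c \<in> c0 \<Gamma>" "\<Gamma> \<noteq> {}"
  shows "norm (bump_sum g h c) = norm c" "bump_sum g h c \<in> SNA"
proof -
  obtain \<gamma> where \<gamma>: "\<gamma> \<in> \<Gamma>" "norm c = \<bar>null_apply c \<gamma>\<bar>"
    using c0_norm_attained[OF c] by metis
  obtain p q where pq: "p \<noteq> q" "g p = \<gamma>" "g q = \<gamma>" "\<bar>h p - h q\<bar> = dist p q"
    using att[OF \<gamma>(1)] by blast
  have "\<bar>lip0_apply (bump_sum g h c) p - lip0_apply (bump_sum g h c) q\<bar>
      = \<bar>null_apply c \<gamma>\<bar> * \<bar>h p - h q\<bar>"
    by (simp add: lip0_apply_bump_sum[OF bf] pq(2,3) right_diff_distrib flip: abs_mult)
  then have slope: "\<bar>lip0_apply (bump_sum g h c) p - lip0_apply (bump_sum g h c) q\<bar> / dist p q = norm c"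
    using pq \<gamma>(2) by simp
  then show "norm (bump_sum g h c) = norm c"
    using lip0_slope_le_norm[of "bump_sum g h c" p q] norm_bump_sum_le[OF bf, of c] by simp
  with slope pq(1) show "bump_sum g h c \<in> SNA"
    unfolding SNA_def by fastforce
qed

text \<open>The isomorphism must run from the image back to \<open>W\<close>, so it is the inverse
  of \<open>f\<close>, which exists because preserving norms forces injectivity on
  \<open>W\<close>.\<close>

lemma isometrically_isomorphic_image:
  fixes f :: "'a :: real_normed_vector \<Rightarrow> 'b :: real_normed_vector"
  assumes f: "linear f" and W: "subspace W" and iso: "\<And>x. x \<in> W \<Longrightarrow> norm (f x) = norm x"
  shows "isometrically_isomorphic (f ` W) W"
proof -
  have inj: "inj_on f W"
  proof (rule inj_onI)
    fix x y assume "x \<in> W" "y \<in> W" "f x = f y"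
    then have "norm (x - y) = 0"
      using iso[of "x - y"] subspace_diff[OF W] by (simp add: linear_diff[OF f])
    then show "x = y" by simp
  qed
  note inv = inv_into_f_f[OF inj]
  show ?thesis
    unfolding isometrically_isomorphic_def
  proof (intro exI[of _ "inv_into W f"] conjI)
    show "bij_betw (inv_into W f) (f ` W) W"
      using inj by (intro bij_betw_inv_into) (simp add: bij_betw_def)
  qed (auto simp: inv iso subspace_add[OF W] subspace_scale[OF W]
      simp flip: linear_add[OF f] linear_scale[OF f])
qed

section \<open>Cones around the points of a discrete set\<close>

lemma bump_family_of_separated_cones:
  fixes p :: "'g \<Rightarrow> 'a :: metric_space"
  assumes r: "\<And>\<gamma>. \<gamma> \<in> \<Gamma> \<Longrightarrow> r \<gamma> > 0"
    and sep: "\<And>\<gamma> \<delta>. \<gamma> \<in> \<Gamma> \<Longrightarrow> \<delta> \<in> \<Gamma> \<Longrightarrow> \<gamma> \<noteq> \<delta> \<Longrightarrow> r \<gamma> + r \<delta> \<le> dist (p \<gamma>) (p \<delta>)"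
  obtains g h where "bump_family g h"
    "\<And>\<gamma> x. \<gamma> \<in> \<Gamma> \<Longrightarrow> dist (p \<gamma>) x < r \<gamma> \<Longrightarrow> g x = \<gamma> \<and> h x = r \<gamma> - dist (p \<gamma>) x"
proof -
  define inside where "inside \<gamma> x \<longleftrightarrow> \<gamma> \<in> \<Gamma> \<and> dist (p \<gamma>) x < r \<gamma>" for \<gamma> x
  \<comment> \<open>The balls are disjoint (\<open>uniq\<close>), so inside a ball the choice is
    forced. Outside all balls it is arbitrary, and the test in \<open>h\<close> sets the height to 0
    there.\<close>
  define g where "g x = (SOME \<gamma>. inside \<gamma> x)" for x
  define h where "h x = (if inside (g x) x then r (g x) - dist (p (g x)) x else 0)" for x
  have uniq: "\<gamma> = \<delta>" if "inside \<gamma> x" "inside \<delta> x" for \<gamma> \<delta> x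
    using that sep[of \<gamma> \<delta>] dist_triangle[of "p \<gamma>" "p \<delta>" x]
    by (force simp: inside_def dist_commute)
  have g: "g x = \<gamma>" if "inside \<gamma> x" for \<gamma> x
    using uniq that unfolding g_def by (metis someI)
  \<comment> \<open>The height of a cone at \<open>x\<close> is at most the distance from
    \<open>x\<close> to any point outside its ball. This settles the pairs with exactly one nonzero
    height.\<close>
  have outside: "r \<gamma> - dist (p \<gamma>) x \<le> dist x y" if "\<gamma> \<in> \<Gamma>" "\<not> inside \<gamma> y" for \<gamma> x y
    using that dist_triangle[of "p \<gamma>" y x] by (simp add: inside_def)
  have "bump_family g h"
    unfolding bump_family_def
  proof (intro conjI allI impI)
    fix x y
    show "0 \<le> h x" by (simp add: h_def inside_def)
    show "\<bar>h x - h y\<bar> \<le> dist x y" if "g x = g y"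
      using that outside[of "g x" x y] outside[of "g x" y x]
        abs_dist_diff_le[of x "p (g x)" y]
      by (auto simp: h_def inside_def dist_commute abs_if split: if_splits)
    show "h x + h y \<le> dist x y" if ne: "g x \<noteq> g y"
    proof (cases "inside (g x) x \<and> inside (g y) y")
      case True
      \<comment> \<open>Walk from one centre through \<open>x\<close> and \<open>y\<close> to the
        other: the two outer legs are what the cones lose in height.\<close>
      then have "r (g x) + r (g y) \<le> dist (p (g x)) (p (g y))"
        using ne sep by (simp add: inside_def)
      also have "\<dots> \<le> dist (p (g x)) x + dist x y + dist (p (g y)) y"
        using dist_triangle[of "p (g x)" "p (g y)" x] dist_triangle[of x "p (g y)" y]
        by (simp add: dist_commute)
      finally show ?thesis
        using True by (simp add: h_def)
    next
      case False
      then consider "inside (g x) x" "h y = 0" | "inside (g y) y" "h x = 0" | "h x = 0" "h y = 0"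
        unfolding h_def by metis
      then show ?thesis
      proof cases
        case 1
        then have "\<not> inside (g x) y" using g ne by metis
        then show ?thesis
          using 1 outside[of "g x" y x] by (simp add: h_def inside_def)
      next
        case 2
        then have "\<not> inside (g y) x" using g ne by metis
        then show ?thesis
          using 2 outside[of "g y" x y] by (simp add: h_def inside_def dist_commute)
      qed simp
    qed
  qed
  moreover have "g x = \<gamma> \<and> h x = r \<gamma> - dist (p \<gamma>) x" if "\<gamma> \<in> \<Gamma>" "dist (p \<gamma>) x < r \<gamma>" for \<gamma> x
    using g[of \<gamma> x] that by (simp add: h_def inside_def)
  ultimately show thesis using that by blast
qed

text \<open>Halved isolation radii work: the distance of two points is at least each of their
  isolation radii, hence at least the average.\<close>

lemma discrete_separated_radii:
  fixes A :: "'a :: metric_space set"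
  assumes "discrete A"
  obtains r where "\<And>x. x \<in> A \<Longrightarrow> r x > 0"
    "\<And>x y. x \<in> A \<Longrightarrow> y \<in> A \<Longrightarrow> x \<noteq> y \<Longrightarrow> r x + r y \<le> dist x y"
proof -
  have "\<forall>x\<in>A. \<exists>e>0. \<forall>y\<in>A. dist x y < e \<longrightarrow> y = x"
    using assms by (auto simp: discrete_def isolated_in_dist_Ex_iff)
  then obtain e where e: "\<And>x. x \<in> A \<Longrightarrow> e x > 0"
    "\<And>x y. x \<in> A \<Longrightarrow> y \<in> A \<Longrightarrow> dist x y < e x \<Longrightarrow> y = x"
    by metis
  show thesis
  proof
    show "e x / 2 > 0" if "x \<in> A" for x using e(1)[OF that] by simp
    show "e x / 2 + e y / 2 \<le> dist x y" if "x \<in> A" "y \<in> A" "x \<noteq> y" for x y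
      using e(2)[of x y] e(2)[of y x] that by (force simp: dist_commute)
  qed
qed

section \<open>The copy of \<open>c0 \<Gamma>\<close> inside \<open>SNA\<close>\<close>

theorem theorem5p2:
  fixes \<Gamma> :: "'g set"
  assumes "infinite \<Gamma>"
    and "has_dens (cluster_points :: 'a :: pointed_metric_space set) \<Gamma>"
  shows "\<exists>V :: 'a lip0 set. subspace V \<and> V \<subseteq> SNA \<and> isometrically_isomorphic V (c0 \<Gamma>)"
proof -
  obtain A E :: "'a set" where A: "A \<subseteq> cluster_points" "discrete A"
    and E: "dense_subset E cluster_points" "|E| \<le>o |A|"
    by (rule exists_discrete_subset_card_dense)
  have "|\<Gamma>| \<le>o |A|"
    using assms(2) E ordLeq_transitive unfolding has_dens_def by blast
  then obtain p where p: "inj_on p \<Gamma>" "p ` \<Gamma> \<subseteq> A"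
    unfolding card_of_ordLeq[symmetric] by blast
  obtain r where r: "\<And>x. x \<in> A \<Longrightarrow> r x > 0"
    "\<And>x y. x \<in> A \<Longrightarrow> y \<in> A \<Longrightarrow> x \<noteq> y \<Longrightarrow> r x + r y \<le> dist x y"
    using discrete_separated_radii[OF A(2)] by metis
  obtain g :: "'a \<Rightarrow> 'g" and h where bf: "bump_family g h"
    and gh: "\<And>\<gamma> x. \<gamma> \<in> \<Gamma> \<Longrightarrow> dist (p \<gamma>) x < r (p \<gamma>) \<Longrightarrow> g x = \<gamma> \<and> h x = r (p \<gamma>) - dist (p \<gamma>) x"
  proof (rule bump_family_of_separated_cones[of \<Gamma> "\<lambda>\<gamma>. r (p \<gamma>)" p])
    show "r (p \<gamma>) > 0" if "\<gamma> \<in> \<Gamma>" for \<gamma> using that r p by blast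
    show "r (p \<gamma>) + r (p \<delta>) \<le> dist (p \<gamma>) (p \<delta>)" if "\<gamma> \<in> \<Gamma>" "\<delta> \<in> \<Gamma>" "\<gamma> \<noteq> \<delta>" for \<gamma> \<delta>
      using that p by (intro r(2)) (auto dest: inj_onD)
  qed blast
  \<comment> \<open>The centre and any other point of its ball have slope 1. Such a point exists
    since the centre is a limit point of the whole space; it need not be a cluster point
    itself.\<close>
  have att: "\<exists>x y. x \<noteq> y \<and> g x = \<gamma> \<and> g y = \<gamma> \<and> \<bar>h x - h y\<bar> = dist x y" if "\<gamma> \<in> \<Gamma>" for \<gamma>
  proof -
    have "p \<gamma> \<in> A" using that p by blast
    then have pos: "r (p \<gamma>) > 0" and "p \<gamma> islimpt UNIV"
      using r A(1) by (auto simp: cluster_points_def)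
    then obtain y where "y \<noteq> p \<gamma>" "dist y (p \<gamma>) < r (p \<gamma>)"
      unfolding islimpt_approachable by blast
    then show ?thesis
      using gh[OF that, of y] gh[OF that, of "p \<gamma>"] pos
      by (intro exI[of _ "p \<gamma>"] exI[of _ y]) (auto simp: dist_commute)
  qed
  have ne: "\<Gamma> \<noteq> {}" using assms(1) by auto
  note iso = bump_sum_isometry_SNA[OF bf att _ ne]
  show ?thesis
  proof (intro exI[of _ "bump_sum g h ` c0 \<Gamma>"] conjI)
    show "subspace (bump_sum g h ` c0 \<Gamma>)"
      by (rule linear_subspace_image[OF linear_bump_sum[OF bf] subspace_c0])
    show "bump_sum g h ` c0 \<Gamma> \<subseteq> SNA"
      using iso(2) by blast
    show "isometrically_isomorphic (bump_sum g h ` c0 \<Gamma>) (c0 \<Gamma>)"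
      by (rule isometrically_isomorphic_image[OF linear_bump_sum[OF bf] subspace_c0 iso(1)])
  qed
qed

end
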